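(* Let $L_0$ be the set of $1$-Lipschitz functions $f:[0,1]\to\mathbb{R}$ with $\int_0^1f(x)\,dx=0$. Every finite multiset $S\subseteq L_0$ is $(1-\frac{\sqrt3}{2})$-close, and this is tight: for every $\delta<1-\frac{\sqrt3}{2}$ there is a finite multiset $S\subseteq L_0$ that is not $\delta$-close.
   Context: A finite multiset $S\subseteq L_0$ with $|S|=n$ is $\delta$-close if there exist $x\in[0,1]$ and $y\in\mathbb{R}$ such that $\frac1n\sum_{f\in S}|f(x)-y|\le\delta$. *)

theory Defs
  imports "HOL-Analysis.Analysis" "HOL-Library.Multiset" "HOL-Library.FuncSet"
begin

text \<open>
  A function on \<open>[0,1]\<close> is represented by the total function that is
  \<open>undefined\<close> outside \<open>[0,1]\<close>, so that elements of \<open>L0\<close>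
  correspond one-to-one to functions on \<open>[0,1]\<close>.
\<close>

definition L0 :: "(real \<Rightarrow> real) set" where
  "L0 = {f \<in> extensional {0..1}. 1-lipschitz_on {0..1} f \<and> (f has_integral 0) {0..1}}"

text \<open>
  Meaningful for nonempty \<open>S\<close> only: for \<open>S = {#}\<close> the average is \<open>0\<close>
  by the convention \<open>1 / 0 = 0\<close>.
\<close>

definition delta_close :: "real \<Rightarrow> (real \<Rightarrow> real) multiset \<Rightarrow> bool" where
  "delta_close \<delta> S \<longleftrightarrow>
     (\<exists>x\<in>{0..1}. \<exists>y::real. 1 / real (size S) * (\<Sum>f\<in>#S. \<bar>f x - y\<bar>) \<le> \<delta>)"

end

theory Submission
  imports Defs
begin

text \<open>
  By minimax duality, the optimal constant is the value of a game. One player mixes functions,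
  and an optimal mixture is uniform on \<open>\<plusminus> g\<close> and \<open>\<plusminus> g'\<close>, where
  \<open>g x = \<bar>x - c\<bar> - 2 * c\<^sup>2\<close> with \<open>c\<^sup>2 = 1 / 2 - c\<close>, and \<open>g'\<close> is the reflection of
  \<open>g\<close>. The other player mixes points \<open>x\<close>, always with \<open>y = 0\<close>: the points
  \<open>1/4, c, 9/20, 11/20, 1 - c, 3/4\<close> with weights \<open>1, 8, 2, 2, 8, 1\<close> are optimal, that is, the
  weighted average of \<open>\<bar>f\<bar>\<close> over them is at most \<open>c\<^sup>2\<close> for every admissible \<open>f\<close>.
  For a fixed sign pattern of \<open>f\<close> at these points, this is a bound on a transport distance
  between a signed discrete measure and a multiple of Lebesgue measure.
\<close>

section \<open>Integral estimates for Lipschitz functions\<close>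

text \<open>Dropping extensionality from \<open>L0\<close> makes the class closed under negation and
  reflection of plain functions.\<close>

definition centered :: "(real \<Rightarrow> real) \<Rightarrow> bool" where
  "centered f \<longleftrightarrow> 1-lipschitz_on {0..1} f \<and> (f has_integral 0) {0..1}"

lemma lipschitz_1_real:
  fixes f :: "real \<Rightarrow> real"
  assumes "1-lipschitz_on X f" "x \<in> X" "y \<in> X"
  shows "\<bar>f x - f y\<bar> \<le> \<bar>x - y\<bar>"
  using lipschitz_onD[OF assms] by (simp add: dist_real_def)

lemma lipschitz_integral_left:
  fixes f :: "real \<Rightarrow> real"
  assumes lip: "1-lipschitz_on {a..b} f" and ab: "a \<le> b"
  shows "\<bar>integral {a..b} f - (b - a) * f a\<bar> \<le> (b - a)\<^sup>2 / 2"
proof -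
  have int: "f integrable_on {a..b}"
    by (intro integrable_continuous_real lipschitz_on_continuous_on[OF lip])
  have "((\<lambda>x. (x - a)\<^sup>2 / 2) has_real_derivative x - a) (at x within {a..b})" for x
    by (auto intro!: derivative_eq_intros)
  then have hi: "((\<lambda>x. x - a) has_integral (b - a)\<^sup>2 / 2) {a..b}"
    using fundamental_theorem_of_calculus[OF ab, of "\<lambda>x. (x - a)\<^sup>2 / 2" "\<lambda>x. x - a"]
    by (simp add: has_real_derivative_iff_has_vector_derivative)
  have "norm (integral {a..b} (\<lambda>x. f x - f a)) \<le> integral {a..b} (\<lambda>x. x - a)"
    using ab lipschitz_1_real[OF lip, of _ a]
    by (intro integral_norm_bound_integral integrable_diff int integrable_const_ivl
        has_integral_integrable[OF hi]) force+
  moreover have "integral {a..b} (\<lambda>x. f x - f a) = integral {a..b} f - (b - a) * f a"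
    using ab int by (subst Henstock_Kurzweil_Integration.integral_diff) auto
  ultimately show ?thesis
    using integral_unique[OF hi] by simp
qed

lemma lipschitz_on_reflect:
  fixes f :: "real \<Rightarrow> real"
  assumes "1-lipschitz_on {c - b..c - a} f"
  shows "1-lipschitz_on {a..b} (\<lambda>x. f (c - x))"
proof (rule lipschitz_onI)
  fix x y assume "x \<in> {a..b}" "y \<in> {a..b}"
  then show "dist (f (c - x)) (f (c - y)) \<le> 1 * dist x y"
    using lipschitz_1_real[OF assms, of "c - x" "c - y"] by (auto simp: dist_real_def)
qed simp

lemma has_integral_reflect_shift:
  fixes f :: "real \<Rightarrow> real"
  assumes "(f has_integral i) {c - b..c - a}"
  shows "((\<lambda>x. f (c - x)) has_integral i) {a..b}"
proof -
  have "(\<lambda>x. c - x) ` {c - b..c - a} = {a..b}"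
    by simp
  then show ?thesis
    using has_integral_affinity[of f i "c - b" "c - a" "- 1" c] assms by simp
qed

lemma lipschitz_integral_right:
  fixes f :: "real \<Rightarrow> real"
  assumes lip: "1-lipschitz_on {a..b} f" and ab: "a \<le> b"
  shows "\<bar>integral {a..b} f - (b - a) * f b\<bar> \<le> (b - a)\<^sup>2 / 2"
proof -
  have "f integrable_on {a..b}"
    by (intro integrable_continuous_real lipschitz_on_continuous_on[OF lip])
  then have "integral {a..b} (\<lambda>x. f (a + b - x)) = integral {a..b} f"
    using has_integral_reflect_shift[of f _ "a + b" b a]
    by (intro integral_unique) (simp add: integrable_integral)
  then show ?thesis
    using lipschitz_integral_left[of a b "\<lambda>x. f (a + b - x)"]
      lipschitz_on_reflect[of "a + b" b a f] lip ab by simp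
qed

lemma centered_uminus: "centered f \<Longrightarrow> centered (\<lambda>x. - f x)"
  using has_integral_neg[of f 0] by (auto simp: centered_def lipschitz_on_def dist_real_def)

lemma centered_reflect: "centered f \<Longrightarrow> centered (\<lambda>x. f (1 - x))"
  using lipschitz_on_reflect[of 1 1 0 f] has_integral_reflect_shift[of f 0 1 1 0]
  by (simp add: centered_def)

text \<open>
  With \<open>F x = C - m * x\<close>, the left-hand side is the integral of \<open>F x * f' x\<close> over
  \<open>{a..b}\<close>, and the right-hand side is the trapezoidal estimate of the integral of \<open>\<bar>F x\<bar>\<close>,
  which is exact when \<open>F\<close> has constant sign.
\<close>

lemma segment_bound:
  fixes f :: "real \<Rightarrow> real" and C m :: real
  assumes lip: "1-lipschitz_on {0..1} f" and ab: "0 \<le> a" "a \<le> b" "b \<le> 1"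
  shows "(C - m * b) * f b - (C - m * a) * f a + m * integral {a..b} f
    \<le> (b - a) / 2 * (\<bar>C - m * a\<bar> + \<bar>C - m * b\<bar>)"
proof (cases "a = b")
  case False
  with ab have "a < b"
    by simp
  define J where "J = integral {a..b} f / (b - a)"
  have I: "integral {a..b} f = (b - a) * J"
    using False by (simp add: J_def)
  have lip': "1-lipschitz_on {a..b} f"
    using lip ab by (auto intro: lipschitz_on_subset)
  have eq: "\<bar>(b - a) * J - (b - a) * y\<bar> = (b - a) * \<bar>J - y\<bar>" for y
    using ab by (simp add: abs_mult right_diff_distrib[symmetric])
  have l: "\<bar>J - f a\<bar> \<le> (b - a) / 2" and r: "\<bar>J - f b\<bar> \<le> (b - a) / 2"
    using lipschitz_integral_left[OF lip'] lipschitz_integral_right[OF lip'] \<open>a < b\<close> mult_le_cancel_left_pos[of "b - a"]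
    unfolding I eq power2_eq_square times_divide_eq_right[symmetric] by auto
  \<comment> \<open>Both endpoint values are compared with the mean \<open>J\<close>, from which
    each differs by at most half the length.\<close>
  have "(C - m * b) * f b - (C - m * a) * f a + m * integral {a..b} f
      = (C - m * a) * (J - f a) - (C - m * b) * (J - f b)"
    unfolding I by (simp add: algebra_simps)
  also have "\<dots> \<le> \<bar>C - m * a\<bar> * \<bar>J - f a\<bar> + \<bar>C - m * b\<bar> * \<bar>J - f b\<bar>"
    unfolding abs_mult[symmetric] by linarith
  also have "\<dots> \<le> \<bar>C - m * a\<bar> * ((b - a) / 2) + \<bar>C - m * b\<bar> * ((b - a) / 2)"
    using l r by (intro add_mono mult_left_mono) auto
  finally show ?thesis
    by (simp add: algebra_simps)
qed simp

section \<open>Transport bounds for weighted point values\<close>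

text \<open>
  The trapezoidal estimate of the integral of \<open>\<bar>G x\<bar>\<close> over \<open>{a..1}\<close>, where \<open>G\<close> starts as
  \<open>C - m * x\<close> and jumps by \<open>v\<close> at \<open>b\<close> for each entry \<open>(b, v)\<close> of the list.
\<close>

fun flow :: "real \<Rightarrow> real \<Rightarrow> real \<Rightarrow> (real \<times> real) list \<Rightarrow> real" where
  "flow m C a [] = (1 - a) / 2 * (\<bar>C - m * a\<bar> + \<bar>C - m\<bar>)"
| "flow m C a ((b, v) # ps) = (b - a) / 2 * (\<bar>C - m * a\<bar> + \<bar>C - m * b\<bar>) + flow m (C + v) b ps"

text \<open>The segment bounds telescope: each jump \<open>v\<close> at \<open>b\<close> leaves
  behind the term \<open>- v * f b\<close>.\<close>

lemma flow_bound:
  fixes f :: "real \<Rightarrow> real"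
  assumes lip: "1-lipschitz_on {0..1} f"
  shows "0 \<le> a \<Longrightarrow> sorted (a # map fst ps @ [1]) \<Longrightarrow>
    (C + (\<Sum>(b, v)\<leftarrow>ps. v) - m) * f 1 - (C - m * a) * f a - (\<Sum>(b, v)\<leftarrow>ps. v * f b)
      + m * integral {a..1} f \<le> flow m C a ps"
proof (induction ps arbitrary: C a)
  case Nil
  then show ?case
    using segment_bound[OF lip, of a 1 C m] by simp
next
  case (Cons p ps)
  obtain b v where p: "p = (b, v)"
    by (cases p)
  have ab: "0 \<le> a" "a \<le> b" "b \<le> 1" "sorted (b # map fst ps @ [1])"
    using Cons.prems by (auto simp: p)
  have "f integrable_on {a..1}"
    using ab lip by (intro integrable_continuous_real continuous_on_subset[OF lipschitz_on_continuous_on]) auto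
  then have "integral {a..1} f = integral {a..b} f + integral {b..1} f"
    using Henstock_Kurzweil_Integration.integral_combine[of a b 1 f] ab by simp
  then show ?case
    using segment_bound[OF lip ab(1-3), of C m] Cons.IH[of b "C + v"] ab
    by (simp add: p algebra_simps)
qed

lemma flow_uminus: "flow (- m) (- C) a (map (\<lambda>(b, v). (b, - v)) ps) = flow m C a ps"
proof (induction ps arbitrary: C a)
  case Nil
  show ?case
    by (simp add: abs_minus_commute)
next
  case (Cons p ps)
  then show ?case
    using Cons.IH[of "C + snd p"] by (cases p) (simp add: abs_minus_commute)
qed

text \<open>Starting at \<open>0\<close> with slope equal to the total weight makes both boundary
  terms vanish; the integral term is zero because \<open>f\<close> is centered. Negating all weights
  gives the other sign.\<close>

lemma weighted_sum_bound:
  assumes "centered f" "sorted (0 # map fst ps @ [1])"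
  shows "\<bar>\<Sum>(b, v)\<leftarrow>ps. v * f b\<bar> \<le> flow (\<Sum>(b, v)\<leftarrow>ps. v) 0 0 ps"
proof -
  have lip: "1-lipschitz_on {0..1} f" and int: "integral {0..1} f = 0"
    using assms by (auto simp: centered_def)
  have *: "- (\<Sum>(b, v)\<leftarrow>ps. v * f b) \<le> flow (\<Sum>(b, v)\<leftarrow>ps. v) 0 0 ps"
    if "sorted (0 # map fst ps @ [1])" for ps
    using flow_bound[OF lip _ that, of 0 "\<Sum>(b, v)\<leftarrow>ps. v"] int by simp
  let ?qs = "map (\<lambda>(b, v). (b, - v)) ps"
  have qs: "(\<Sum>(b, v)\<leftarrow>?qs. v) = - (\<Sum>(b, v)\<leftarrow>ps. v)"
    "(\<Sum>(b, v)\<leftarrow>?qs. v * f b) = - (\<Sum>(b, v)\<leftarrow>ps. v * f b)"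
    "map fst ?qs = map fst ps"
    by (induction ps) auto
  have "flow (\<Sum>(b, v)\<leftarrow>?qs. v) 0 0 ?qs = flow (\<Sum>(b, v)\<leftarrow>ps. v) 0 0 ps"
    using flow_uminus[of "\<Sum>(b, v)\<leftarrow>ps. v" 0 0 ps] unfolding qs by simp
  then show ?thesis
    using *[of ps] *[of ?qs] assms(2) unfolding qs by (simp add: abs_le_iff)
qed

section \<open>The six-point inequality\<close>

definition c0 :: real where "c0 = (sqrt 3 - 1) / 2"

lemma c0_square: "c0 * c0 = 1 / 2 - c0" and c0_square_eq: "c0\<^sup>2 = 1 - sqrt 3 / 2"
proof -
  have "2 * c0 + 1 = sqrt 3"
    by (simp add: c0_def diff_divide_distrib)
  then have "(2 * c0 + 1)\<^sup>2 = 3"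
    by simp
  then show "c0 * c0 = 1 / 2 - c0"
    by (simp add: power2_eq_square algebra_simps)
  then show "c0\<^sup>2 = 1 - sqrt 3 / 2"
    by (simp add: c0_def power2_eq_square diff_divide_distrib)
qed

lemma c0_bounds: "0.366 \<le> c0" "c0 \<le> 0.36603"
proof -
  have "1.732 \<le> sqrt 3"
    by (rule real_le_rsqrt) (simp add: power2_eq_square)
  moreover have "sqrt 3 \<le> 1.73206"
    by (rule real_le_lsqrt) (simp_all add: power2_eq_square)
  ultimately show "0.366 \<le> c0" "c0 \<le> 0.36603"
    by (simp_all add: c0_def)
qed

text \<open>The sign patterns that are attained by \<open>\<plusminus> g\<close>, whose zero \<open>1 - c\<close> is one of the points.\<close>

lemma tight_pattern:
  assumes f: "centered f" and s: "s = 1 \<or> s = - 1"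
  shows "\<bar>f (1/4) + 8 * f c0 + 2 * f (9/20) + 2 * f (11/20) + s * 8 * f (1 - c0) - f (3/4)\<bar>
    \<le> 22 * c0\<^sup>2"
proof -
  let ?ps = "[(1/4, 1), (c0, 8), (9/20, 2), (11/20, 2), (1 - c0, s * 8), (3/4, - 1)]"
  have c0_square': "c0 * (c0 * x) = (1 / 2 - c0) * x" for x
    by (simp add: c0_square mult.assoc[symmetric])
  \<comment> \<open>For both values of \<open>s\<close>, sign changes occur only at breakpoints, so
    no trapezoid overestimates. The bounds on \<open>c0\<close> decide the signs, and
    \<open>c0_square\<close> makes the rest linear in \<open>c0\<close>.\<close>
  have flow: "flow (\<Sum>(b, v)\<leftarrow>?ps. v) 0 0 ?ps = 22 * c0\<^sup>2"
    using s c0_bounds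
    by (elim disjE) (simp_all add: power2_eq_square c0_square c0_square' algebra_simps
      add_divide_distrib diff_divide_distrib)
  have "\<bar>\<Sum>(b, v)\<leftarrow>?ps. v * f b\<bar> \<le> 22 * c0\<^sup>2"
    unfolding flow[symmetric] using c0_bounds by (intro weighted_sum_bound f) simp
  then show ?thesis
    by (simp add: algebra_simps)
qed

text \<open>
  The other sign patterns leave enough room to replace \<open>c0\<close> by the rational \<open>183/500\<close>, so that
  the bound is evaluated by rational arithmetic. The breakpoint \<open>1/2\<close> of weight \<open>0\<close> only makes
  the trapezoidal estimate more precise.
\<close>

lemma slack_pattern:
  fixes s1 s2 s3 s4 s5 s6 :: real
  assumes "s1 = 1 \<or> s1 = - 1" "s2 = 1 \<or> s2 = - 1" "s3 = 1 \<or> s3 = - 1"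
    "s4 = 1 \<or> s4 = - 1" "s5 = 1 \<or> s5 = - 1" "s6 = 1 \<or> s6 = - 1"
  assumes "\<not> (s2 = s1 \<and> s3 = s1 \<and> s4 = s1 \<and> s6 = - s1)" "\<not> (s5 = s6 \<and> s4 = s6 \<and> s3 = s6 \<and> s1 = - s6)"
  defines "ps \<equiv> [(1/4, s1), (183/500, s2 * 8), (9/20, s3 * 2), (1/2, 0), (11/20, s4 * 2),
    (317/500, s5 * 8), (3/4, s6)]"
  shows "flow (\<Sum>(b, v)\<leftarrow>ps. v) 0 0 ps \<le> 2946 / 1000"
  unfolding ps_def
  \<comment> \<open>Each of the 64 sign vectors is either excluded or a rational
    computation.\<close>
  using assms(1-8) by (elim disjE) simp_all

lemma obtain_sign:
  fixes x :: real
  obtains s :: real where "s = 1 \<or> s = - 1" "\<bar>x\<bar> = s * x"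
  by (cases "x \<ge> 0") (auto intro: that[of 1] that[of "- 1"])

lemma abs_sum_bound:
  assumes f: "centered f"
  shows "\<bar>f (1/4)\<bar> + 8 * \<bar>f c0\<bar> + 2 * \<bar>f (9/20)\<bar> + 2 * \<bar>f (11/20)\<bar> + 8 * \<bar>f (1 - c0)\<bar> + \<bar>f (3/4)\<bar>
    \<le> 22 * c0\<^sup>2" (is "?L \<le> _")
proof -
  obtain s1 where s1: "s1 = 1 \<or> s1 = - 1" "\<bar>f (1/4)\<bar> = s1 * f (1/4)"
    by (rule obtain_sign)
  obtain s2 where s2: "s2 = 1 \<or> s2 = - 1" "\<bar>f c0\<bar> = s2 * f c0"
    by (rule obtain_sign)
  obtain s3 where s3: "s3 = 1 \<or> s3 = - 1" "\<bar>f (9/20)\<bar> = s3 * f (9/20)"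
    by (rule obtain_sign)
  obtain s4 where s4: "s4 = 1 \<or> s4 = - 1" "\<bar>f (11/20)\<bar> = s4 * f (11/20)"
    by (rule obtain_sign)
  obtain s5 where s5: "s5 = 1 \<or> s5 = - 1" "\<bar>f (1 - c0)\<bar> = s5 * f (1 - c0)"
    by (rule obtain_sign)
  obtain s6 where s6: "s6 = 1 \<or> s6 = - 1" "\<bar>f (3/4)\<bar> = s6 * f (3/4)"
    by (rule obtain_sign)
  consider (left) "s2 = s1 \<and> s3 = s1 \<and> s4 = s1 \<and> s6 = - s1"
    | (right) "s5 = s6 \<and> s4 = s6 \<and> s3 = s6 \<and> s1 = - s6"
    | (slack) "\<not> (s2 = s1 \<and> s3 = s1 \<and> s4 = s1 \<and> s6 = - s1)"
        "\<not> (s5 = s6 \<and> s4 = s6 \<and> s3 = s6 \<and> s1 = - s6)"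
    by blast
  then show ?thesis
  proof cases
    case left
    have "?L = s1 * (f (1/4) + 8 * f c0 + 2 * f (9/20) + 2 * f (11/20) + s1 * s5 * 8 * f (1 - c0) - f (3/4))"
      unfolding s1(2) s2(2) s3(2) s4(2) s5(2) s6(2) using s1(1) left by (elim disjE) simp_all
    also have "\<dots> \<le> \<bar>f (1/4) + 8 * f c0 + 2 * f (9/20) + 2 * f (11/20) + s1 * s5 * 8 * f (1 - c0) - f (3/4)\<bar>"
      using s1(1) by (elim disjE) simp_all
    also have "\<dots> \<le> 22 * c0\<^sup>2"
      using s1(1) s5(1) by (intro tight_pattern f) auto
    finally show ?thesis .
  next
    case right
    have "?L = s6 * (f (3/4) + 8 * f (1 - c0) + 2 * f (11/20) + 2 * f (9/20) + s6 * s2 * 8 * f c0 - f (1/4))"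
      unfolding s1(2) s2(2) s3(2) s4(2) s5(2) s6(2) using s6(1) right by (elim disjE) simp_all
    also have "\<dots> \<le> \<bar>f (3/4) + 8 * f (1 - c0) + 2 * f (11/20) + 2 * f (9/20) + s6 * s2 * 8 * f c0 - f (1/4)\<bar>"
      using s6(1) by (elim disjE) simp_all
    also have "\<dots> \<le> 22 * c0\<^sup>2"
      \<comment> \<open>Reflection swaps the points in pairs and turns this pattern into the
        previous one.\<close>
      using tight_pattern[OF centered_reflect[OF f], of "s6 * s2"] s2(1) s6(1) by auto
    finally show ?thesis .
  next
    case slack
    have lip: "1-lipschitz_on {0..1} f"
      using f by (simp add: centered_def)
    let ?ps = "[(1/4 :: real, s1), (183/500, s2 * 8), (9/20, s3 * 2), (1/2, 0), (11/20, s4 * 2),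
      (317/500, s5 * 8), (3/4, s6)]"
    have "\<bar>\<Sum>(b, v)\<leftarrow>?ps. v * f b\<bar> \<le> flow (\<Sum>(b, v)\<leftarrow>?ps. v) 0 0 ?ps"
      by (rule weighted_sum_bound[OF f]) simp
    also have "\<dots> \<le> 2946 / 1000"
      by (rule slack_pattern[OF s1(1) s2(1) s3(1) s4(1) s5(1) s6(1) slack])
    finally have "(\<Sum>(b, v)\<leftarrow>?ps. v * f b) \<le> 2946 / 1000"
      by linarith
    \<comment> \<open>Moving the two points of weight 8 costs at most
      \<open>16 * 3 / 100000\<close>, less than the gap between \<open>2946 / 1000\<close> and
      \<open>2947 / 1000\<close>.\<close>
    moreover have "s2 * f c0 \<le> s2 * f (183/500) + 3 / 100000"
      using lipschitz_1_real[OF lip, of c0 "183/500"] c0_bounds s2(1) by auto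
    moreover have "s5 * f (1 - c0) \<le> s5 * f (317/500) + 3 / 100000"
      using lipschitz_1_real[OF lip, of "1 - c0" "317/500"] c0_bounds s5(1) by auto
    moreover have "2947 / 1000 \<le> 22 * c0\<^sup>2"
      using c0_bounds by (simp add: power2_eq_square c0_square)
    ultimately show ?thesis
      unfolding s1(2) s2(2) s3(2) s4(2) s5(2) s6(2) by simp
  qed
qed

section \<open>Upper bound by averaging\<close>

lemma L0_centered: "f \<in> L0 \<Longrightarrow> centered f"
  by (simp add: L0_def centered_def)

lemma delta_close_upper:
  assumes "S \<noteq> {#}" "set_mset S \<subseteq> L0"
  shows "delta_close (1 - sqrt 3 / 2) S"
proof -
  define A where "A x = (\<Sum>f\<in>#S. \<bar>f x\<bar>)" for x
  have size: "real (size S) > 0"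
    using assms(1) by (simp add: nonempty_has_size)
  have "A (1/4) + 8 * A c0 + 2 * A (9/20) + 2 * A (11/20) + 8 * A (1 - c0) + A (3/4)
    \<le> 22 * (c0\<^sup>2 * size S)"
    using assms(2) unfolding A_def
  proof (induction S)
    case empty
    show ?case
      by simp
  next
    case (add f S)
    then show ?case
      using abs_sum_bound[OF L0_centered, of f] by (simp add: algebra_simps)
  qed
  \<comment> \<open>The weights add up to 22, so not all six values can exceed the average.\<close>
  then have "\<exists>x\<in>{1/4, c0, 9/20, 11/20, 1 - c0, 3/4}. A x \<le> c0\<^sup>2 * size S"
    by (rule contrapos_pp) (simp add: not_le)
  then obtain x where x: "x \<in> {1/4, c0, 9/20, 11/20, 1 - c0, 3/4}" "A x \<le> c0\<^sup>2 * size S"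
    by blast
  have "x \<in> {0..1}"
    using x(1) c0_bounds by auto
  moreover have "1 / real (size S) * (\<Sum>f\<in>#S. \<bar>f x - 0\<bar>) \<le> 1 - sqrt 3 / 2"
    using x(2) size by (simp add: A_def c0_square_eq pos_divide_le_eq)
  ultimately show ?thesis
    unfolding delta_close_def by blast
qed

section \<open>Extremal functions\<close>

text \<open>The subtracted constant is the mean of \<open>\<bar>x - c\<bar>\<close> over
  \<open>{0..1}\<close>.\<close>

definition tent :: "real \<Rightarrow> real \<Rightarrow> real" where
  "tent c x = \<bar>x - c\<bar> - (c\<^sup>2 + (1 - c)\<^sup>2) / 2"

lemma centered_tent:
  assumes "0 \<le> c" "c \<le> 1"
  shows "centered (tent c)"
  unfolding centered_def
proof
  show "1-lipschitz_on {0..1} (tent c)"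
    by (rule lipschitz_onI) (auto simp: tent_def dist_real_def)
  have "((\<lambda>x. - (x - c)\<^sup>2 / 2) has_real_derivative c - x) (at x within {0..c})" for x
    by (auto intro!: derivative_eq_intros simp: diff_divide_distrib)
  then have "((\<lambda>x. c - x) has_integral c\<^sup>2 / 2) {0..c}"
    using fundamental_theorem_of_calculus[OF assms(1), of "\<lambda>x. - (x - c)\<^sup>2 / 2" "\<lambda>x. c - x"]
    by (simp add: has_real_derivative_iff_has_vector_derivative)
  then have left: "((\<lambda>x. \<bar>x - c\<bar>) has_integral c\<^sup>2 / 2) {0..c}"
    by (rule has_integral_eq[rotated]) simp
  have "((\<lambda>x. (x - c)\<^sup>2 / 2) has_real_derivative x - c) (at x within {c..1})" for x
    by (auto intro!: derivative_eq_intros)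
  then have "((\<lambda>x. x - c) has_integral (1 - c)\<^sup>2 / 2) {c..1}"
    using fundamental_theorem_of_calculus[OF assms(2), of "\<lambda>x. (x - c)\<^sup>2 / 2" "\<lambda>x. x - c"]
    by (simp add: has_real_derivative_iff_has_vector_derivative)
  then have right: "((\<lambda>x. \<bar>x - c\<bar>) has_integral (1 - c)\<^sup>2 / 2) {c..1}"
    by (rule has_integral_eq[rotated]) simp
  have "((\<lambda>x. \<bar>x - c\<bar>) has_integral c\<^sup>2 / 2 + (1 - c)\<^sup>2 / 2) {0..1}"
    by (rule has_integral_combine[OF assms left right])
  then show "(tent c has_integral 0) {0..1}"
    using has_integral_diff[OF _ has_integral_const_real[of "(c\<^sup>2 + (1 - c)\<^sup>2) / 2" 0 1]]
    unfolding tent_def by (fastforce simp: add_divide_distrib)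
qed

lemma restrict_in_L0:
  assumes "centered f"
  shows "restrict f {0..1} \<in> L0"
proof -
  have "(restrict f {0..1} has_integral 0) {0..1}"
    using assms by (auto simp: centered_def intro: has_integral_eq[rotated])
  moreover have "1-lipschitz_on {0..1} (restrict f {0..1})"
    using assms by (auto simp: centered_def lipschitz_on_def)
  ultimately show ?thesis
    by (simp add: L0_def)
qed

text \<open>Equality holds between \<open>3 * c0 - 1\<close> and \<open>2 - 3 * c0\<close>, where
  the slopes of the two absolute values cancel; outside, both tents are positive and grow towards
  the ends.\<close>

lemma tents_lower_bound:
  assumes "0 \<le> x" "x \<le> 1"
  shows "2 * c0\<^sup>2 \<le> \<bar>tent c0 x\<bar> + \<bar>tent (1 - c0) x\<bar>"
proof -
  have t: "tent c0 x = \<bar>x - c0\<bar> - (1 - 2 * c0)" "tent (1 - c0) x = \<bar>x - (1 - c0)\<bar> - (1 - 2 * c0)"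
    by (simp_all add: tent_def power2_eq_square algebra_simps c0_square add_divide_distrib diff_divide_distrib)
  show ?thesis
    unfolding t using c0_bounds assms by (simp add: power2_eq_square c0_square abs_if)
qed

theorem theorem6:
  shows "(\<forall>S. S \<noteq> {#} \<and> set_mset S \<subseteq> L0 \<longrightarrow> delta_close (1 - sqrt 3 / 2) S) \<and>
         (\<forall>\<delta>::real. \<delta> < 1 - sqrt 3 / 2 \<longrightarrow>
            (\<exists>S. S \<noteq> {#} \<and> set_mset S \<subseteq> L0 \<and> \<not> delta_close \<delta> S))"
proof (intro conjI allI impI)
  fix S :: "(real \<Rightarrow> real) multiset"
  assume "S \<noteq> {#} \<and> set_mset S \<subseteq> L0"
  then show "delta_close (1 - sqrt 3 / 2) S"
    by (simp add: delta_close_upper)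
next
  fix \<delta> :: real
  assume \<delta>: "\<delta> < 1 - sqrt 3 / 2"
  define g where "g = (\<lambda>c. restrict (tent c) {0..1})"
  define g' where "g' = (\<lambda>c. restrict (\<lambda>x. - tent c x) {0..1})"
  define S where "S = {#g c0, g' c0, g (1 - c0), g' (1 - c0)#}"
  have "centered (tent c0)" "centered (tent (1 - c0))"
    using c0_bounds by (auto intro!: centered_tent)
  then have "set_mset S \<subseteq> L0"
    by (auto simp: S_def g_def g'_def intro!: restrict_in_L0 centered_uminus)
  moreover have "\<not> delta_close \<delta> S"
  proof
    assume "delta_close \<delta> S"
    then obtain x y where x: "x \<in> {0..1}"
      and "1 / real (size S) * (\<Sum>f\<in>#S. \<bar>f x - y\<bar>) \<le> \<delta>"
      by (auto simp: delta_close_def)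
    then have "\<bar>tent c0 x - y\<bar> + \<bar>- tent c0 x - y\<bar>
        + \<bar>tent (1 - c0) x - y\<bar> + \<bar>- tent (1 - c0) x - y\<bar> \<le> 4 * \<delta>"
      by (simp add: S_def g_def g'_def)
    \<comment> \<open>For each pair of opposite values \<open>a\<close> and \<open>- a\<close>, the
      distances to \<open>y\<close> sum to at least \<open>2 * \<bar>a\<bar>\<close>, so no
      \<open>y\<close> beats 0.\<close>
    then have "\<bar>tent c0 x\<bar> + \<bar>tent (1 - c0) x\<bar> \<le> 2 * \<delta>"
      by linarith
    then show False
      using tents_lower_bound[of x] x \<delta> by (simp add: c0_square_eq)
  qed
  ultimately show "\<exists>S. S \<noteq> {#} \<and> set_mset S \<subseteq> L0 \<and> \<not> delta_close \<delta> S"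
    by (intro exI[of _ S]) (simp add: S_def)
qed

end
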